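(* Let $f:\{0,1\}^n\to\{0,1\}$ be a symmetric Boolean function with $I(f)$ intervals. Then $NN(f)\le I(f)$. Moreover, let $\mathbf{J}\in\mathbb{R}^{(I(f)-1)\times n}$ denote the all-ones matrix and let $M\in\mathbb{R}^{(I(f)-1)\times n}$ be any matrix of full row rank. Then for every sufficiently small $\epsilon>0$, with $B=\mathbf{J}+\epsilon M$, there exists an $I(f)$ interval-anchor assignment for $f$ with anchors $a_1,\dots,a_{I(f)}\in\mathbb{R}^n$ satisfying $a_{(i+1)j}-a_{ij}=b_{ij}$ for all $i\in\{1,\dots,I(f)-1\}$ and $j\in\{1,\dots,n\}$ (here $a_{ij}$ is the $j$-th entry of $a_i$).
   Context: For $X\in\{0,1\}^n$, $|X|$ denotes the number of ones in $X$; $d(\cdot,\cdot)$ is the Euclidean distance. A Boolean function $f$ is symmetric if $f(X)$ depends only on $|X|$. A Nearest Neighbor (NN) representation of $f$ is a pair of disjoint finite sets $P,N\subset\mathbb{R}^n$ (anchors; those in $P$ are positive, those in $N$ negative) such that for every $X$ with $f(X)=1$ there is $p\in P$ with $d(X,p)<d(X,q)$ for all $q\in N$, and for every $X$ with $f(X)=0$ there is $q\in N$ with $d(X,q)<d(X,p)$ for all $p\in P$. Its size is $|P\cup N|$, and $NN(f)$ is the minimum size of an NN representation of $f$. The intervals of a symmetric $f$ are the maximal sets of consecutive integers in $\{0,\dots,n\}$ on which $f$ (as a function of $|X|$) is constant; $I(f)$ is their number. Ordering them increasingly, write the $i$-th interval as $\{I_{i-1}+1,\dots,I_i\}$ with $I_0=-1$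 and $I_{I(f)}=n$. An $I(f)$ interval-anchor assignment for $f$ is an NN representation of $f$ with exactly $I(f)$ anchors $a_1,\dots,a_{I(f)}$, where $a_i$ is positive iff $f$ equals $1$ on the $i$-th interval, such that every $X\in\{0,1\}^n$ with $|X|$ in the $i$-th interval satisfies $d(X,a_i)<d(X,a_k)$ for all $k\ne i$. *)

theory Defs
  imports "HOL-Analysis.Analysis"
begin

text \<open>Points of $\{0,1\}^n$ are of type \<^typ>\<open>bool ^ 'n\<close>, with $n$ = CARD('n); \<open>cube_point\<close> places
  them in $\mathbb{R}^n$.\<close>

definition cube_point :: "bool ^ 'n \<Rightarrow> real ^ 'n" where
  "cube_point X = (\<chi> j. of_bool (X $ j))"

definition weight :: "bool ^ 'n \<Rightarrow> nat" where
  "weight X = card {j. X $ j}"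

definition symmetric_bf :: "(bool ^ 'n \<Rightarrow> bool) \<Rightarrow> bool" where
  "symmetric_bf f \<longleftrightarrow> (\<forall>X Y. weight X = weight Y \<longrightarrow> f X = f Y)"

definition nn_representation ::
    "(bool ^ 'n \<Rightarrow> bool) \<Rightarrow> (real ^ 'n) set \<Rightarrow> (real ^ 'n) set \<Rightarrow> bool" where
  "nn_representation f P N \<longleftrightarrow>
     finite P \<and> finite N \<and> P \<inter> N = {} \<and>
     (\<forall>X. f X \<longrightarrow> (\<exists>p\<in>P. \<forall>q\<in>N. dist (cube_point X) p < dist (cube_point X) q)) \<and>
     (\<forall>X. \<not> f X \<longrightarrow> (\<exists>q\<in>N. \<forall>p\<in>P. dist (cube_point X) q < dist (cube_point X) p))"

definition NN :: "(bool ^ 'n \<Rightarrow> bool) \<Rightarrow> nat" where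
  "NN f = (LEAST s. \<exists>P N. nn_representation f P N \<and> card (P \<union> N) = s)"

definition constant_on_weights :: "(bool ^ 'n \<Rightarrow> bool) \<Rightarrow> nat set \<Rightarrow> bool" where
  "constant_on_weights f S \<longleftrightarrow> (\<forall>X Y. weight X \<in> S \<longrightarrow> weight Y \<in> S \<longrightarrow> f X = f Y)"

definition constant_runs :: "(bool ^ 'n \<Rightarrow> bool) \<Rightarrow> nat set set" where
  "constant_runs f =
     {S. \<exists>a b. S = {a..b} \<and> a \<le> b \<and> b \<le> CARD('n) \<and> constant_on_weights f S}"

definition intervals :: "(bool ^ 'n \<Rightarrow> bool) \<Rightarrow> nat set set" where
  "intervals f = {S \<in> constant_runs f. \<forall>T \<in> constant_runs f. S \<subseteq> T \<longrightarrow> S = T}"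

definition num_intervals :: "(bool ^ 'n \<Rightarrow> bool) \<Rightarrow> nat" where
  "num_intervals f = card (intervals f)"

text \<open>The number $I_i$: the right end of the $i$-th interval, with $I_0 = -1$.\<close>

definition interval_end :: "(bool ^ 'n \<Rightarrow> bool) \<Rightarrow> nat \<Rightarrow> int" where
  "interval_end f i =
     (if i = 0 then - 1 else int (sorted_list_of_set (Max ` intervals f) ! (i - 1)))"

definition nth_interval :: "(bool ^ 'n \<Rightarrow> bool) \<Rightarrow> nat \<Rightarrow> nat set" where
  "nth_interval f i = {k. interval_end f (i - 1) + 1 \<le> int k \<and> int k \<le> interval_end f i}"

definition positive_interval :: "(bool ^ 'n \<Rightarrow> bool) \<Rightarrow> nat \<Rightarrow> bool" where
  "positive_interval f i \<longleftrightarrow> (\<forall>X. weight X \<in> nth_interval f i \<longrightarrow> f X)"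

text \<open>Only the values of \<open>a\<close> at \<open>1, \<dots>, num_intervals f\<close> matter.\<close>

definition interval_anchor_assignment ::
    "(bool ^ 'n \<Rightarrow> bool) \<Rightarrow> (nat \<Rightarrow> real ^ 'n) \<Rightarrow> bool" where
  "interval_anchor_assignment f a \<longleftrightarrow>
     nn_representation f
       (a ` {i \<in> {1..num_intervals f}. positive_interval f i})
       (a ` {i \<in> {1..num_intervals f}. \<not> positive_interval f i}) \<and>
     card (a ` {1..num_intervals f}) = num_intervals f \<and>
     (\<forall>i \<in> {1..num_intervals f}. \<forall>X. weight X \<in> nth_interval f i \<longrightarrow>
        (\<forall>k \<in> {1..num_intervals f}. k \<noteq> i \<longrightarrow>
           dist (cube_point X) (a i) < dist (cube_point X) (a k)))"

text \<open>A real $m \times n$ matrix is given by its rows \<open>M 1, \<dots>, M m\<close>, since $m$ depends on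
  the function \<open>f\<close> and may be 0. Its rank is the dimension of the row space.\<close>

definition full_row_rank :: "nat \<Rightarrow> (nat \<Rightarrow> real ^ 'n) \<Rightarrow> bool" where
  "full_row_rank m M \<longleftrightarrow> dim (span (M ` {1..m})) = m"

definition all_ones :: "nat \<Rightarrow> real ^ 'n" where
  "all_ones i = (\<chi> j. 1)"

lemma nn_representation_exists:
  "\<exists>P N. nn_representation (f :: bool ^ 'n \<Rightarrow> bool) P N"
proof -
  have inj: "X = Y" if "cube_point X = cube_point Y" for X Y :: "bool ^ 'n"
    using that by (auto simp: cube_point_def vec_eq_iff of_bool_eq_iff)
  have "nn_representation f (cube_point ` {X. f X}) (cube_point ` {X. \<not> f X})"
    unfolding nn_representation_def
  proof (intro conjI allI impI)
    show "cube_point ` {X. f X} \<inter> cube_point ` {X. \<not> f X} = {}"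
      using inj by auto
  next
    fix X assume "f X"
    then show "\<exists>p\<in>cube_point ` {X. f X}. \<forall>q\<in>cube_point ` {X. \<not> f X}.
        dist (cube_point X) p < dist (cube_point X) q"
      using inj by (intro bexI[of _ "cube_point X"]) auto
  next
    fix X assume "\<not> f X"
    then show "\<exists>q\<in>cube_point ` {X. \<not> f X}. \<forall>p\<in>cube_point ` {X. f X}.
        dist (cube_point X) q < dist (cube_point X) p"
      using inj by (intro bexI[of _ "cube_point X"]) auto
  qed auto
  then show ?thesis by blast
qed

lemma NN_attained:
  "\<exists>P N. nn_representation f P N \<and> card (P \<union> N) = NN f"
proof -
  have "\<exists>s P N. nn_representation f P N \<and> card (P \<union> N) = s"
    using nn_representation_exists[of f] by blast
  from LeastI_ex[OF this] show ?thesis unfolding NN_def .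
qed

lemma ex_weight:
  assumes "k \<le> CARD('n)"
  shows "\<exists>X :: bool ^ 'n. weight X = k"
proof -
  obtain S :: "'n set" where "card S = k"
    using assms obtain_subset_with_card_n by blast
  then have "weight (\<chi> j. j \<in> S) = k" by (simp add: weight_def)
  then show ?thesis by blast
qed

lemma weight_le: "weight (X :: bool ^ 'n) \<le> CARD('n)"
  unfolding weight_def by (intro card_mono) auto

lemma finite_constant_runs: "finite (constant_runs (f :: bool ^ 'n \<Rightarrow> bool))"
  by (rule finite_subset[of _ "Pow {0..CARD('n)}"]) (auto simp: constant_runs_def)

lemma finite_intervals: "finite (intervals f)"
  using finite_constant_runs[of f] by (simp add: intervals_def)

lemma intervals_disjoint:
  fixes f :: "bool ^ 'n \<Rightarrow> bool"
  assumes S: "S \<in> intervals f" and T: "T \<in> intervals f" and k: "k \<in> S" "k \<in> T"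
  shows "S = T"
proof -
  from S obtain a b where ab: "S = {a..b}" "a \<le> b" "b \<le> CARD('n)" "constant_on_weights f S"
    by (auto simp: intervals_def constant_runs_def)
  from T obtain c d where cd: "T = {c..d}" "c \<le> d" "d \<le> CARD('n)" "constant_on_weights f T"
    by (auto simp: intervals_def constant_runs_def)
  have U: "S \<union> T = {min a c..max b d}" using ab(1) cd(1) k by auto
  obtain Z :: "bool ^ 'n" where Z: "weight Z = k"
    using ex_weight[of k] k ab(1,3) by force
  have "f X = f Z" if "weight X \<in> S \<union> T" for X
    using that ab(4) cd(4) k unfolding constant_on_weights_def Z[symmetric] by blast
  then have "constant_on_weights f (S \<union> T)" by (simp add: constant_on_weights_def)
  moreover have "min a c \<le> max b d" "max b d \<le> CARD('n)" using ab cd by auto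
  ultimately have "S \<union> T \<in> constant_runs f"
    unfolding constant_runs_def using U by blast
  then show ?thesis using S T by (auto simp: intervals_def)
qed

lemma intervals_cover:
  fixes f :: "bool ^ 'n \<Rightarrow> bool"
  assumes "symmetric_bf f" and "k \<le> CARD('n)"
  shows "\<exists>S \<in> intervals f. k \<in> S"
proof -
  have "constant_on_weights f {k}"
    using assms(1) by (simp add: constant_on_weights_def symmetric_bf_def)
  then have "{k} \<in> constant_runs f"
    unfolding constant_runs_def using assms(2) atLeastAtMost_singleton[of k] by blast
  then obtain S where "S \<in> constant_runs f" "{k} \<subseteq> S"
      "\<forall>T \<in> constant_runs f. S \<subseteq> T \<longrightarrow> S = T"
    using finite_has_maximal2[OF finite_constant_runs[of f], of "{k}"] by blast
  then show ?thesis unfolding intervals_def by blast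
qed

lemma nth_interval_bij:
  fixes f :: "bool ^ 'n \<Rightarrow> bool"
  assumes "symmetric_bf f"
  shows "bij_betw (nth_interval f) {1..num_intervals f} (intervals f)"
    and "strict_mono_on {0..num_intervals f} (interval_end f)"
    and "interval_end f (num_intervals f) = int CARD('n)"
proof -
  define L where "L = sorted_list_of_set (Max ` intervals f)"
  have form: "\<exists>a. S = {a..Max S} \<and> a \<le> Max S \<and> Max S \<le> CARD('n) \<and> Max S \<in> S"
    if S: "S \<in> intervals f" for S
  proof -
    obtain a b where "S = {a..b}" "a \<le> b" "b \<le> CARD('n)"
      using S by (auto simp: intervals_def constant_runs_def)
    moreover from this have "Max S = b" by (intro Max_eqI) auto
    ultimately show ?thesis by (intro exI[of _ a]) simp
  qed
  have MaxS: "Max S \<in> S" if "S \<in> intervals f" for S using form[OF that] by blast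
  have Max_le: "Max S \<le> CARD('n)" if "S \<in> intervals f" for S using form[OF that] by blast
  have injMax: "inj_on Max (intervals f)"
  proof (rule inj_onI)
    fix S T assume ST: "S \<in> intervals f" "T \<in> intervals f" "Max S = Max T"
    show "S = T"
      using intervals_disjoint[OF ST(1,2) MaxS[OF ST(1)]] MaxS[OF ST(2)] ST(3) by simp
  qed
  have setL: "set L = Max ` intervals f" by (simp add: L_def finite_intervals)
  have lenL: "length L = num_intervals f"
    by (simp add: L_def num_intervals_def card_image injMax)
  have sortL: "sorted_wrt (<) L" by (simp add: L_def)
  have mono: "L ! i < L ! j" if "i < j" "j < length L" for i j
    using sortL that by (simp add: sorted_wrt_nth_less)
  have mono_le: "L ! i \<le> L ! j" if "i \<le> j" "j < length L" for i j
    using mono[of i j] that by (cases "i = j") auto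
  have ie: "interval_end f (Suc i) = int (L ! i)" for i by (simp add: interval_end_def L_def)
  have pred: "a - 1 \<in> set L" if S: "{a..b} \<in> intervals f" and "a \<le> b" "0 < a" for a b
  proof -
    have "Max {a..b} = b" using \<open>a \<le> b\<close> by (intro Max_eqI) auto
    then have "b \<le> CARD('n)" using Max_le[OF S] by simp
    then have "a - 1 \<le> CARD('n)" using \<open>a \<le> b\<close> by linarith
    then obtain T where T: "T \<in> intervals f" "a - 1 \<in> T"
      using intervals_cover[OF assms] by blast
    then obtain c where c: "T = {c..Max T}" "c \<le> Max T" using form by blast
    have "a \<notin> T"
    proof
      assume "a \<in> T"
      then have "T = {a..b}" using intervals_disjoint[OF T(1) S] \<open>a \<le> b\<close> by simp
      then have "a \<le> a - 1" using T(2) by simp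
      then show False using \<open>0 < a\<close> by linarith
    qed
    moreover have "c \<le> a - 1" "a - 1 \<le> Max T" using T(2) c(1) by (metis atLeastAtMost_iff)+
    moreover have "a \<in> T \<longleftrightarrow> c \<le> a \<and> a \<le> Max T" using c(1) by (metis atLeastAtMost_iff)
    ultimately have "Max T = a - 1" using \<open>0 < a\<close> by linarith
    then show ?thesis using T(1) setL by (metis imageI)
  qed
  have key: "nth_interval f (Suc i) \<in> intervals f \<and> Max (nth_interval f (Suc i)) = L ! i"
    if i: "i < length L" for i
  proof -
    obtain S where S: "S \<in> intervals f" "Max S = L ! i"
      using i setL nth_mem[OF i] by auto
    obtain a where a: "S = {a..L ! i}" "a \<le> L ! i" using form[OF S(1)] unfolding S(2) by blast
    have "interval_end f i + 1 = int a"
    proof (cases i)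
      case 0
      have "a = 0"
      proof (rule ccontr)
        assume "a \<noteq> 0"
        then obtain j where "j < length L" "L ! j = a - 1"
          using pred[of a "L ! i"] S a by (metis in_set_conv_nth neq0_conv)
        then have "L ! j < L ! 0" using a(2) \<open>a \<noteq> 0\<close> 0 by simp
        with mono[of 0 j] \<open>j < length L\<close> show False by (cases j) auto
      qed
      then show ?thesis using 0 by (simp add: interval_end_def)
    next
      case (Suc m)
      have m: "L ! m < L ! i" "m < length L" using mono[of m i] i Suc by auto
      obtain T where T: "T \<in> intervals f" "Max T = L ! m"
        using setL nth_mem[OF m(2)] by auto
      have "L ! m < a"
      proof (rule ccontr)
        assume "\<not> L ! m < a"
        then have "L ! m \<in> S" using a m by auto
        moreover have "L ! m \<in> T" using MaxS[OF T(1)] T(2) by simp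
        ultimately have "S = T" using intervals_disjoint S T by blast
        then show False using S T m by simp
      qed
      then obtain j where j: "j < length L" "L ! j = a - 1"
        using pred[of a "L ! i"] S a by (metis in_set_conv_nth gr_implies_not0 neq0_conv)
      have "j \<le> m"
      proof (rule ccontr)
        assume "\<not> j \<le> m"
        then have "L ! i \<le> L ! j" using mono_le[of i j] j(1) Suc by simp
        then show False using j(2) a(2) \<open>L ! m < a\<close> by linarith
      qed
      then have "a - 1 \<le> L ! m" using j(2) mono_le[OF _ m(2)] by metis
      then have "a = L ! m + 1" using \<open>L ! m < a\<close> by linarith
      then show ?thesis using Suc ie by simp
    qed
    then have "nth_interval f (Suc i) = S" unfolding nth_interval_def using a ie by auto
    then show ?thesis using S by simp
  qed
  show "bij_betw (nth_interval f) {1..num_intervals f} (intervals f)"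
  proof (rule bij_betw_imageI)
    show inj: "inj_on (nth_interval f) {1..num_intervals f}"
    proof (rule inj_onI)
      fix x y assume xy: "x \<in> {1..num_intervals f}" "y \<in> {1..num_intervals f}"
        "nth_interval f x = nth_interval f y"
      then obtain i j where ij: "x = Suc i" "y = Suc j" "i < length L" "j < length L"
        using lenL by (cases x; cases y) auto
      then have "L ! i = L ! j" using key xy(3) by metis
      then have "i = j" using mono ij by (metis nat_neq_iff)
      then show "x = y" using ij by simp
    qed
    have "nth_interval f ` {1..num_intervals f} \<subseteq> intervals f"
    proof
      fix S assume "S \<in> nth_interval f ` {1..num_intervals f}"
      then obtain x where "S = nth_interval f x" "x \<in> {1..num_intervals f}" by blast
      then show "S \<in> intervals f" using key[of "x - 1"] lenL by auto
    qed
    then show "nth_interval f ` {1..num_intervals f} = intervals f"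
      using inj by (intro card_subset_eq) (auto simp: finite_intervals card_image num_intervals_def)
  qed
  show "strict_mono_on {0..num_intervals f} (interval_end f)"
  proof (rule strict_mono_onI)
    fix x y assume xy: "x \<in> {0..num_intervals f}" "y \<in> {0..num_intervals f}" "x < y"
    then obtain j where j: "y = Suc j" "j < length L" using lenL by (cases y) auto
    show "interval_end f x < interval_end f y"
    proof (cases x)
      case 0
      then show ?thesis using j ie by (simp add: interval_end_def)
    next
      case (Suc i)
      then show ?thesis using j ie mono[of i j] xy by simp
    qed
  qed
  obtain S where S: "S \<in> intervals f" "CARD('n) \<in> S"
    using intervals_cover[OF assms, of "CARD('n)"] by blast
  have "CARD('n) \<le> Max S" using form[OF S(1)] S(2) by (metis atLeastAtMost_iff)
  then have "Max S = CARD('n)" using Max_le[OF S(1)] by simp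
  then obtain j where j: "j < length L" "L ! j = CARD('n)"
    using S setL by (metis imageI in_set_conv_nth)
  have last: "L ! (length L - 1) \<in> set L" using j by auto
  then obtain T where "T \<in> intervals f" "L ! (length L - 1) = Max T" unfolding setL by (rule imageE)
  then have "L ! (length L - 1) \<le> CARD('n)" using Max_le[of T] by linarith
  moreover have "L ! j \<le> L ! (length L - 1)"
    using mono_le[of j "length L - 1"] j(1) by simp
  ultimately have "L ! (length L - 1) = CARD('n)" using j by simp
  then show "interval_end f (num_intervals f) = int CARD('n)"
    using ie[of "length L - 1"] j lenL by simp
qed

end

theory Submission
  imports Defs
begin

text \<open>Put \<open>a (i + 1) = a i + B i\<close>. Then
  \<open>d(X, a (i + 1))\<^sup>2 - d(X, a i)\<^sup>2 = \<bar>a (i + 1)\<bar>\<^sup>2 - \<bar>a i\<bar>\<^sup>2 - 2 X \<bullet> B i\<close>, and \<open>X \<bullet> B i\<close> is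
  within \<open>1/2\<close> of the weight of \<open>X\<close> when \<open>\<epsilon>\<close> is small. Since the rows of \<open>B\<close> are linearly
  independent for all but at most one positive \<open>\<epsilon>\<close>, the first anchor can be chosen such that
  \<open>\<bar>a (i + 1)\<bar>\<^sup>2 - \<bar>a i\<bar>\<^sup>2 = 2 (I\<^sub>i + 1/2)\<close> for every \<open>i\<close>. So \<open>X\<close> is closer to \<open>a (i + 1)\<close> than
  to \<open>a i\<close> exactly if its weight exceeds \<open>I\<^sub>i\<close>, and along the sequence of anchors the distance
  from \<open>X\<close> strictly decreases up to the interval of its weight and strictly increases
  afterwards.\<close>

lemma inj_on_independent_image_iff:
  fixes M :: "'i \<Rightarrow> 'a::real_vector"
  assumes "finite I"
  shows "inj_on M I \<and> independent (M ` I) \<longleftrightarrow>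
    (\<forall>c. (\<Sum>i\<in>I. c i *\<^sub>R M i) = 0 \<longrightarrow> (\<forall>i\<in>I. c i = 0))" (is "?L \<longleftrightarrow> ?R")
proof
  assume L: ?L
  show ?R
  proof (intro allI impI)
    fix c :: "'i \<Rightarrow> real" assume c: "(\<Sum>i\<in>I. c i *\<^sub>R M i) = 0"
    let ?u = "\<lambda>v. c (the_inv_into I M v)"
    have "(\<Sum>v\<in>M ` I. ?u v *\<^sub>R v) = (\<Sum>i\<in>I. c i *\<^sub>R M i)"
      using L by (simp add: sum.reindex the_inv_into_f_f)
    then have "\<forall>v\<in>M ` I. ?u v = 0"
      using L c assms dependent_finite[of "M ` I"] by auto
    then show "\<forall>i\<in>I. c i = 0"
      using L by (simp add: the_inv_into_f_f)
  qed
next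
  assume R: ?R
  have inj: "inj_on M I"
  proof (rule inj_onI, rule ccontr)
    fix i j assume ij: "i \<in> I" "j \<in> I" "M i = M j" "i \<noteq> j"
    let ?c = "\<lambda>k. (if k = i then 1 else 0) - (if k = j then 1 else 0) :: real"
    have "(\<Sum>k\<in>I. ?c k *\<^sub>R M k) =
        (\<Sum>k\<in>I. if k = i then M k else 0) - (\<Sum>k\<in>I. if k = j then M k else 0)"
      unfolding sum_subtractf[symmetric] by (intro sum.cong) (auto simp: algebra_simps)
    also have "\<dots> = 0" using ij assms by simp
    finally have "?c i = 0" using R[rule_format, of ?c i] ij(1) by simp
    then show False using ij(4) by simp
  qed
  moreover have "independent (M ` I)"
  proof (rule independent_if_scalars_zero)
    show "finite (M ` I)" using assms by simp
    fix u v assume u: "(\<Sum>x\<in>M ` I. u x *\<^sub>R x) = 0" and "v \<in> M ` I"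
    then show "u v = 0"
      using R[rule_format, of "u \<circ> M"] inj by (auto simp: sum.reindex)
  qed
  ultimately show ?L by blast
qed

lemma independent_inner_solvable:
  fixes B :: "'i \<Rightarrow> 'a::euclidean_space"
  assumes "inj_on B I" and "independent (B ` I)"
  shows "\<exists>x. \<forall>i\<in>I. B i \<bullet> x = c i"
proof -
  obtain g :: "'a \<Rightarrow> real" where g: "linear g"
      "\<forall>v\<in>B ` I. g v = c (the_inv_into I B v)"
    using linear_independent_extend[OF assms(2), of "\<lambda>v. c (the_inv_into I B v)"] by auto
  have "B i \<bullet> adjoint g 1 = c i" if "i \<in> I" for i
    using adjoint_works[OF g(1), of "B i" 1] g(2) that assms(1) by (simp add: the_inv_into_f_f)
  then show ?thesis by blast
qed

text \<open>A dependency at \<open>\<epsilon>\<close>, scaled to coefficient sum \<open>1\<close>, gives \<open>u + \<epsilon> * \<Sum>i. c i * M i = 0\<close>.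
  Independence of \<open>M\<close> determines \<open>\<epsilon> * c\<close> and hence its coordinate sum \<open>\<epsilon>\<close>, so that at most
  one \<open>\<epsilon> > 0\<close> is exceptional.\<close>

lemma eventually_independent_add_scaleR:
  fixes M :: "'i \<Rightarrow> 'a::real_vector" and u :: 'a
  assumes fin: "finite I" and M: "inj_on M I" "independent (M ` I)"
  shows "\<exists>\<delta>>0. \<forall>\<epsilon>. 0 < \<epsilon> \<and> \<epsilon> < \<delta> \<longrightarrow>
    inj_on (\<lambda>i. u + \<epsilon> *\<^sub>R M i) I \<and> independent ((\<lambda>i. u + \<epsilon> *\<^sub>R M i) ` I)"
proof -
  define good where "good \<epsilon> \<longleftrightarrow> (\<forall>c. (\<Sum>i\<in>I. c i *\<^sub>R (u + \<epsilon> *\<^sub>R M i)) = 0 \<longrightarrow> (\<forall>i\<in>I. c i = 0))" for \<epsilon>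
  have indep: "\<forall>i\<in>I. c i = 0" if "(\<Sum>i\<in>I. c i *\<^sub>R M i) = 0" for c
    using inj_on_independent_image_iff[OF fin, of M] M that by blast
  have expand: "(\<Sum>i\<in>I. c i *\<^sub>R (u + \<epsilon> *\<^sub>R M i)) = sum c I *\<^sub>R u + (\<Sum>i\<in>I. (\<epsilon> * c i) *\<^sub>R M i)" for c \<epsilon>
    by (simp add: scaleR_right_distrib sum.distrib scaleR_sum_left mult.commute)
  have normal: "\<exists>c. sum c I = 1 \<and> u + (\<Sum>i\<in>I. (\<epsilon> * c i) *\<^sub>R M i) = 0"
    if bad: "\<not> good \<epsilon>" and pos: "0 < \<epsilon>" for \<epsilon>
  proof -
    obtain c where c: "(\<Sum>i\<in>I. c i *\<^sub>R (u + \<epsilon> *\<^sub>R M i)) = 0" "\<not> (\<forall>i\<in>I. c i = 0)"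
      using bad by (auto simp: good_def)
    define s where "s = sum c I"
    have s: "s \<noteq> 0"
    proof
      assume "s = 0"
      then have "(\<Sum>i\<in>I. (\<epsilon> * c i) *\<^sub>R M i) = 0" using c(1) expand[of c \<epsilon>] s_def by simp
      then have "\<forall>i\<in>I. \<epsilon> * c i = 0" by (rule indep)
      then show False using c(2) pos by simp
    qed
    have "(\<Sum>i\<in>I. (c i / s) *\<^sub>R (u + \<epsilon> *\<^sub>R M i)) = (1 / s) *\<^sub>R (\<Sum>i\<in>I. c i *\<^sub>R (u + \<epsilon> *\<^sub>R M i))"
      unfolding scaleR_sum_right by (intro sum.cong) simp_all
    then have "(\<Sum>i\<in>I. (c i / s) *\<^sub>R (u + \<epsilon> *\<^sub>R M i)) = 0" using c(1) by simp
    moreover have "(\<Sum>i\<in>I. c i / s) = 1"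
      using s by (simp add: s_def flip: sum_divide_distrib)
    ultimately show ?thesis using expand[of "\<lambda>i. c i / s" \<epsilon>] by (intro exI[of _ "\<lambda>i. c i / s"]) simp
  qed
  have unique: "\<epsilon> = \<epsilon>'" if bad: "\<not> good \<epsilon>" "\<not> good \<epsilon>'" and pos: "0 < \<epsilon>" "0 < \<epsilon>'" for \<epsilon> \<epsilon>'
  proof -
    obtain c where c: "sum c I = 1" "u + (\<Sum>i\<in>I. (\<epsilon> * c i) *\<^sub>R M i) = 0"
      using normal[OF bad(1) pos(1)] by blast
    obtain c' where c': "sum c' I = 1" "u + (\<Sum>i\<in>I. (\<epsilon>' * c' i) *\<^sub>R M i) = 0"
      using normal[OF bad(2) pos(2)] by blast
    have "(\<Sum>i\<in>I. (\<epsilon> * c i - \<epsilon>' * c' i) *\<^sub>R M i) = 0"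
      using c(2) c'(2) by (simp add: scaleR_left_diff_distrib sum_subtractf add_eq_0_iff)
    then have "\<forall>i\<in>I. \<epsilon> * c i - \<epsilon>' * c' i = 0" by (rule indep)
    then have "(\<Sum>i\<in>I. \<epsilon> * c i) = (\<Sum>i\<in>I. \<epsilon>' * c' i)" by (intro sum.cong) auto
    then show ?thesis using c(1) c'(1) by (simp flip: sum_distrib_left)
  qed
  have "\<exists>\<delta>>0. \<forall>\<epsilon>. 0 < \<epsilon> \<and> \<epsilon> < \<delta> \<longrightarrow> good \<epsilon>"
  proof (cases "\<exists>\<epsilon>>0. \<not> good \<epsilon>")
    case True
    then show ?thesis using unique by (metis less_irrefl)
  next
    case False
    then show ?thesis by (intro exI[of _ 1]) auto
  qed
  then show ?thesis
    using inj_on_independent_image_iff[OF fin] unfolding good_def by blast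
qed

lemma full_row_rankD:
  assumes "full_row_rank m M"
  shows "inj_on M {1..m}" and "independent (M ` {1..m})"
proof -
  have dim: "dim (M ` {1..m}) = m"
    using assms by (simp add: full_row_rank_def)
  have "dim (M ` {1..m}) \<le> card (M ` {1..m})"
    by (intro dim_le_card') simp
  moreover have "card (M ` {1..m}) \<le> m"
    using card_image_le[of "{1..m}" M] by simp
  ultimately have card: "card (M ` {1..m}) = m" using dim by simp
  then show "inj_on M {1..m}" by (intro eq_card_imp_inj_on) auto
  show "independent (M ` {1..m})"
    using card dim by (intro card_le_dim_spanning[of _ "span (M ` {1..m})"]) (auto simp: span_superset)
qed

lemma ex_full_row_rank:
  assumes "m \<le> CARD('n)"
  shows "\<exists>M :: nat \<Rightarrow> real ^ 'n. full_row_rank m M"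
proof -
  have "m \<le> card (Basis :: (real ^ 'n) set)" using assms by simp
  then obtain S where S: "S \<subseteq> (Basis :: (real ^ 'n) set)" "card S = m"
    using obtain_subset_with_card_n by metis
  have "finite S" using S(1) finite_Basis finite_subset by blast
  then obtain M where M: "bij_betw M {1..m} S"
    using S(2) finite_same_card_bij[of "{1..m}" S] by auto
  have "independent S" using S(1) independent_Basis independent_mono by blast
  then have "dim (span (M ` {1..m})) = m"
    using M S(2) by (simp add: bij_betw_def dim_eq_card_independent)
  then show ?thesis unfolding full_row_rank_def by blast
qed

lemma inner_cube_point: "cube_point X \<bullet> v = (\<Sum>j | X $ j. v $ j)"
proof -
  have "cube_point X \<bullet> v = (\<Sum>j\<in>UNIV. if X $ j then v $ j else 0)"
    unfolding inner_vec_def cube_point_def by (intro sum.cong) auto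
  then show ?thesis by (simp add: sum.If_cases)
qed

lemma inner_cube_point_all_ones: "cube_point X \<bullet> all_ones i = real (weight X)"
  by (simp add: inner_cube_point all_ones_def weight_def)

lemma abs_inner_cube_point_le: "\<bar>cube_point X \<bullet> v\<bar> \<le> (\<Sum>j\<in>UNIV. \<bar>v $ j\<bar>)"
proof -
  have "\<bar>cube_point X \<bullet> v\<bar> \<le> (\<Sum>j | X $ j. \<bar>v $ j\<bar>)"
    unfolding inner_cube_point by (rule sum_abs)
  also have "\<dots> \<le> (\<Sum>j\<in>UNIV. \<bar>v $ j\<bar>)" by (intro sum_mono2) auto
  finally show ?thesis .
qed

lemma ex_nth_interval:
  fixes f :: "bool ^ 'n \<Rightarrow> bool" and X :: "bool ^ 'n"
  assumes "symmetric_bf f"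
  shows "\<exists>i\<in>{1..num_intervals f}. weight X \<in> nth_interval f i"
proof -
  obtain S where S: "S \<in> intervals f" "weight X \<in> S"
    using intervals_cover[OF assms weight_le] by blast
  have "S \<in> nth_interval f ` {1..num_intervals f}"
    using S(1) nth_interval_bij(1)[OF assms] by (simp add: bij_betw_def)
  then obtain i where "i \<in> {1..num_intervals f}" "S = nth_interval f i" by (rule imageE)
  then show ?thesis using S(2) by (intro bexI[of _ i]) simp_all
qed

lemma ex_weight_nth_interval:
  fixes f :: "bool ^ 'n \<Rightarrow> bool"
  assumes "symmetric_bf f" and "i \<in> {1..num_intervals f}"
  shows "\<exists>X :: bool ^ 'n. weight X \<in> nth_interval f i"
proof -
  have "nth_interval f i \<in> intervals f"
    using nth_interval_bij(1)[OF assms(1)] assms(2) by (auto simp: bij_betw_def)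
  then obtain a b where "nth_interval f i = {a..b}" "a \<le> b" "b \<le> CARD('n)"
    by (auto simp: intervals_def constant_runs_def)
  moreover obtain X :: "bool ^ 'n" where "weight X = b"
    using ex_weight calculation(3) by blast
  ultimately show ?thesis by (intro exI[of _ X]) simp
qed

lemma positive_interval_iff:
  fixes f :: "bool ^ 'n \<Rightarrow> bool"
  assumes "symmetric_bf f" and "i \<in> {1..num_intervals f}" and "weight X \<in> nth_interval f i"
  shows "positive_interval f i \<longleftrightarrow> f X"
proof -
  have "nth_interval f i \<in> intervals f"
    using nth_interval_bij(1)[OF assms(1)] assms(2) by (auto simp: bij_betw_def)
  then have "constant_on_weights f (nth_interval f i)"
    by (auto simp: intervals_def constant_runs_def)
  then show ?thesis
    using assms(3) unfolding positive_interval_def constant_on_weights_def by blast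
qed

lemma num_intervals_le:
  fixes f :: "bool ^ 'n \<Rightarrow> bool"
  assumes "symmetric_bf f"
  shows "num_intervals f \<le> CARD('n) + 1"
proof -
  have "int i - 1 \<le> interval_end f i" if "i \<le> num_intervals f" for i
    using that
  proof (induction i)
    case 0
    then show ?case by (simp add: interval_end_def)
  next
    case (Suc i)
    then have "interval_end f i < interval_end f (Suc i)"
      using nth_interval_bij(2)[OF assms] by (auto intro: strict_mono_onD)
    then show ?case using Suc by simp
  qed
  from this[of "num_intervals f"] show ?thesis
    using nth_interval_bij(3)[OF assms] by simp
qed

lemma interval_anchor_assignmentI:
  fixes f :: "bool ^ 'n \<Rightarrow> bool"
  assumes sym: "symmetric_bf f"
    and nearest: "\<And>i k X. i \<in> {1..num_intervals f} \<Longrightarrow> k \<in> {1..num_intervals f} \<Longrightarrow> k \<noteq> i \<Longrightarrow>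
      weight X \<in> nth_interval f i \<Longrightarrow> dist (cube_point X) (a i) < dist (cube_point X) (a k)"
  shows "interval_anchor_assignment f a"
proof -
  have inj: "inj_on a {1..num_intervals f}"
  proof (rule inj_onI, rule ccontr)
    fix i k assume ik: "i \<in> {1..num_intervals f}" "k \<in> {1..num_intervals f}" "a i = a k" "i \<noteq> k"
    obtain X :: "bool ^ 'n" where "weight X \<in> nth_interval f i"
      using ex_weight_nth_interval[OF sym ik(1)] by blast
    then show False using nearest[of i k X] ik by simp
  qed
  have "nn_representation f
      (a ` {i \<in> {1..num_intervals f}. positive_interval f i})
      (a ` {i \<in> {1..num_intervals f}. \<not> positive_interval f i})"
    (is "nn_representation f ?P ?N")
    unfolding nn_representation_def
  proof (intro conjI allI impI)
    show "finite ?P" "finite ?N" by simp_all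
    show "?P \<inter> ?N = {}" using inj by (auto dest: inj_onD)
  next
    fix X assume "f X"
    obtain i where i: "i \<in> {1..num_intervals f}" "weight X \<in> nth_interval f i"
      using ex_nth_interval[OF sym] by blast
    have "positive_interval f i" using positive_interval_iff[OF sym i] \<open>f X\<close> by simp
    then show "\<exists>p\<in>?P. \<forall>q\<in>?N. dist (cube_point X) p < dist (cube_point X) q"
      using i nearest[of i _ X] by (intro bexI[of _ "a i"]) auto
  next
    fix X assume "\<not> f X"
    obtain i where i: "i \<in> {1..num_intervals f}" "weight X \<in> nth_interval f i"
      using ex_nth_interval[OF sym] by blast
    have "\<not> positive_interval f i" using positive_interval_iff[OF sym i] \<open>\<not> f X\<close> by simp
    then show "\<exists>q\<in>?N. \<forall>p\<in>?P. dist (cube_point X) q < dist (cube_point X) p"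
      using i nearest[of i _ X] by (intro bexI[of _ "a i"]) auto
  qed
  then show ?thesis
    unfolding interval_anchor_assignment_def using inj nearest by (simp add: card_image)
qed

lemma NN_le_num_intervals:
  assumes "interval_anchor_assignment f a"
  shows "NN f \<le> num_intervals f"
proof -
  let ?P = "a ` {i \<in> {1..num_intervals f}. positive_interval f i}"
  let ?N = "a ` {i \<in> {1..num_intervals f}. \<not> positive_interval f i}"
  have "?P \<union> ?N = a ` {1..num_intervals f}" by blast
  then have "nn_representation f ?P ?N \<and> card (?P \<union> ?N) = num_intervals f"
    using assms by (simp add: interval_anchor_assignment_def)
  then show ?thesis unfolding NN_def by (intro Least_le) blast
qed

lemma strict_unimodal_less:
  fixes D :: "nat \<Rightarrow> real"
  assumes down: "\<And>k. 1 \<le> k \<Longrightarrow> k < i \<Longrightarrow> D (Suc k) < D k"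
    and up: "\<And>k. i \<le> k \<Longrightarrow> k < m \<Longrightarrow> D k < D (Suc k)"
    and k: "1 \<le> k" "k \<le> m" "k \<noteq> i"
  shows "D i < D k"
proof (cases "k < i")
  case True
  then have "Suc k \<le> i" by simp
  then show ?thesis
  proof (induction rule: dec_induct)
    case base
    then show ?case using down k True by simp
  next
    case (step l)
    then have "D (Suc l) < D l" using down k by simp
    then show ?case using step by simp
  qed
next
  case False
  then have "Suc i \<le> k" using k by simp
  then show ?thesis using k(2)
  proof (induction rule: dec_induct)
    case base
    then show ?case using up[of i] by simp
  next
    case (step l)
    then have "D l < D (Suc l)" using up[of l] by simp
    then show ?case using step by simp
  qed
qed

lemma interval_anchor_assignment_of_increments:
  fixes f :: "bool ^ 'n \<Rightarrow> bool" and B :: "nat \<Rightarrow> real ^ 'n"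
  assumes sym: "symmetric_bf f"
    and inj: "inj_on B {1..num_intervals f - 1}"
    and ind: "independent (B ` {1..num_intervals f - 1})"
    and close: "\<And>i X. i \<in> {1..num_intervals f - 1} \<Longrightarrow>
      \<bar>cube_point X \<bullet> B i - real (weight X)\<bar> < 1 / 2"
  shows "\<exists>a. interval_anchor_assignment f a \<and>
    (\<forall>i\<in>{1..num_intervals f - 1}. a (i + 1) - a i = B i)"
proof -
  define t where "t i = real_of_int (interval_end f i) + 1 / 2" for i
  define S where "S i = (\<Sum>k\<in>{1..<i}. B k)" for i
  obtain x where x: "\<forall>i\<in>{1..num_intervals f - 1}. B i \<bullet> x = t i - B i \<bullet> B i / 2 - B i \<bullet> S i"
    using independent_inner_solvable[OF inj ind, of "\<lambda>i. t i - B i \<bullet> B i / 2 - B i \<bullet> S i"] by blast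
  define a where "a i = x + S i" for i
  have step: "a (Suc i) = a i + B i" if "1 \<le> i" for i
    using that by (simp add: a_def S_def)
  have diff: "(dist (cube_point X) (a (Suc k)))\<^sup>2 - (dist (cube_point X) (a k))\<^sup>2
      = 2 * (t k - cube_point X \<bullet> B k)" if k: "k \<in> {1..num_intervals f - 1}" for k X
  proof -
    have "B k \<bullet> a k = t k - B k \<bullet> B k / 2"
      using x k by (simp add: a_def inner_add_right)
    moreover have "a (Suc k) = a k + B k" using step k by simp
    ultimately show ?thesis
      by (simp add: dist_norm power2_norm_eq_inner inner_diff_left inner_diff_right
          inner_add_left inner_add_right inner_commute algebra_simps)
  qed
  have mono: "interval_end f k \<le> interval_end f l" if "k \<le> l" "l \<le> num_intervals f" for k l
    using strict_mono_onD[OF nth_interval_bij(2)[OF sym], of k l] that by (cases "k = l") auto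
  have "interval_anchor_assignment f a"
  proof (rule interval_anchor_assignmentI[OF sym])
    fix i k and X :: "bool ^ 'n"
    assume i: "i \<in> {1..num_intervals f}" and k: "k \<in> {1..num_intervals f}" "k \<noteq> i"
      and X: "weight X \<in> nth_interval f i"
    have "(dist (cube_point X) (a i))\<^sup>2 < (dist (cube_point X) (a k))\<^sup>2"
    proof (rule strict_unimodal_less[where m = "num_intervals f"])
      fix l assume l: "1 \<le> l" "l < i"
      have "interval_end f l \<le> interval_end f (i - 1)" using mono l i by simp
      then have "interval_end f l + 1 \<le> int (weight X)" using X by (simp add: nth_interval_def)
      then have "t l + 1 / 2 \<le> real (weight X)" unfolding t_def by linarith
      moreover have l': "l \<in> {1..num_intervals f - 1}" using l i by auto
      ultimately have "t l < cube_point X \<bullet> B l"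
        using close[OF l', of X] unfolding abs_less_iff by linarith
      then show "(dist (cube_point X) (a (Suc l)))\<^sup>2 < (dist (cube_point X) (a l))\<^sup>2"
        using diff[OF l', of X] by simp
    next
      fix l assume l: "i \<le> l" "l < num_intervals f"
      have "interval_end f i \<le> interval_end f l" using mono l by simp
      then have "int (weight X) \<le> interval_end f l" using X by (simp add: nth_interval_def)
      then have "real (weight X) \<le> t l - 1 / 2" unfolding t_def by linarith
      moreover have l': "l \<in> {1..num_intervals f - 1}" using l i by auto
      ultimately have "cube_point X \<bullet> B l < t l"
        using close[OF l', of X] unfolding abs_less_iff by linarith
      then show "(dist (cube_point X) (a l))\<^sup>2 < (dist (cube_point X) (a (Suc l)))\<^sup>2"
        using diff[OF l', of X] by simp
    qed (use k in auto)
    then show "dist (cube_point X) (a i) < dist (cube_point X) (a k)"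
      by (rule power_less_imp_less_base) simp
  qed
  then show ?thesis using step by (intro exI[of _ a]) simp
qed

lemma ex_interval_anchor_assignment:
  fixes f :: "bool ^ 'n \<Rightarrow> bool" and M :: "nat \<Rightarrow> real ^ 'n"
  assumes sym: "symmetric_bf f" and M: "full_row_rank (num_intervals f - 1) M"
  shows "\<exists>\<epsilon>\<^sub>0>0. \<forall>\<epsilon>. 0 < \<epsilon> \<and> \<epsilon> < \<epsilon>\<^sub>0 \<longrightarrow>
    (\<exists>a. interval_anchor_assignment f a \<and>
      (\<forall>i\<in>{1..num_intervals f - 1}. a (i + 1) - a i = all_ones i + \<epsilon> *\<^sub>R M i))"
proof -
  define m where "m = num_intervals f - 1"
  define u :: "real ^ 'n" where "u = (\<chi> j. 1)"
  have ones: "all_ones i = u" for i by (simp add: all_ones_def u_def)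
  obtain \<delta> where \<delta>: "\<delta> > 0" "\<And>\<epsilon>. 0 < \<epsilon> \<Longrightarrow> \<epsilon> < \<delta> \<Longrightarrow>
      inj_on (\<lambda>i. u + \<epsilon> *\<^sub>R M i) {1..m} \<and> independent ((\<lambda>i. u + \<epsilon> *\<^sub>R M i) ` {1..m})"
    using eventually_independent_add_scaleR[OF finite_atLeastAtMost full_row_rankD[OF M], of u]
    unfolding m_def by blast
  define K where "K = (\<Sum>i\<in>{1..m}. \<Sum>j\<in>UNIV. \<bar>M i $ j\<bar>)"
  have K: "0 \<le> K" unfolding K_def by (intro sum_nonneg) auto
  have bound: "\<bar>cube_point X \<bullet> M i\<bar> \<le> K" if "i \<in> {1..m}" for i X
  proof -
    have "(\<Sum>j\<in>UNIV. \<bar>M i $ j\<bar>) \<le> K"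
      unfolding K_def by (rule member_le_sum[OF that]) (auto intro: sum_nonneg)
    then show ?thesis using abs_inner_cube_point_le[of X "M i"] by linarith
  qed
  show ?thesis
  proof (intro exI[of _ "min \<delta> (1 / (2 * K + 2))"] conjI allI impI)
    show "0 < min \<delta> (1 / (2 * K + 2))" using \<delta>(1) K by simp
    fix \<epsilon> assume \<epsilon>: "0 < \<epsilon> \<and> \<epsilon> < min \<delta> (1 / (2 * K + 2))"
    then have "\<epsilon> * (2 * K + 2) < 1" using K by (simp add: field_simps)
    then have \<epsilon>K: "\<epsilon> * K < 1 / 2" using \<epsilon> by (simp add: algebra_simps)
    have "\<bar>cube_point X \<bullet> (u + \<epsilon> *\<^sub>R M i) - real (weight X)\<bar> < 1 / 2" if "i \<in> {1..m}" for i X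
    proof -
      have "\<epsilon> * \<bar>cube_point X \<bullet> M i\<bar> \<le> \<epsilon> * K"
        using bound[OF that] \<epsilon> by (intro mult_left_mono) auto
      then have "\<epsilon> * \<bar>cube_point X \<bullet> M i\<bar> < 1 / 2" using \<epsilon>K by simp
      moreover have "cube_point X \<bullet> u = real (weight X)"
        using inner_cube_point_all_ones[of X] by (simp add: ones)
      ultimately show ?thesis using \<epsilon> by (simp add: inner_add_right abs_mult)
    qed
    then show "\<exists>a. interval_anchor_assignment f a \<and>
        (\<forall>i\<in>{1..num_intervals f - 1}. a (i + 1) - a i = all_ones i + \<epsilon> *\<^sub>R M i)"
      using \<delta>(2)[of \<epsilon>] \<epsilon> unfolding m_def ones
      by (intro interval_anchor_assignment_of_increments[OF sym]) auto
  qed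
qed

theorem theorem3:
  fixes f :: "bool ^ 'n \<Rightarrow> bool"
  assumes "symmetric_bf f"
  shows "NN f \<le> num_intervals f \<and>
    (\<forall>M :: nat \<Rightarrow> real ^ 'n. full_row_rank (num_intervals f - 1) M \<longrightarrow>
      (\<exists>\<epsilon>\<^sub>0 > 0. \<forall>\<epsilon>. 0 < \<epsilon> \<and> \<epsilon> < \<epsilon>\<^sub>0 \<longrightarrow>
        (\<forall>B. (\<forall>i. B i = all_ones i + \<epsilon> *\<^sub>R M i) \<longrightarrow>
          (\<exists>a. interval_anchor_assignment f a \<and>
            (\<forall>i \<in> {1..num_intervals f - 1}. \<forall>j. a (i + 1) $ j - a i $ j = B i $ j)))))"
proof (intro conjI allI impI)
  have "num_intervals f - 1 \<le> CARD('n)" using num_intervals_le[OF assms] by simp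
  then obtain M :: "nat \<Rightarrow> real ^ 'n" where "full_row_rank (num_intervals f - 1) M"
    using ex_full_row_rank by metis
  from ex_interval_anchor_assignment[OF assms this] obtain \<epsilon>\<^sub>0 :: real where "\<epsilon>\<^sub>0 > 0"
      "\<And>\<epsilon>. 0 < \<epsilon> \<and> \<epsilon> < \<epsilon>\<^sub>0 \<Longrightarrow> \<exists>a. interval_anchor_assignment f a"
    by blast
  from this(2)[of "\<epsilon>\<^sub>0 / 2"] this(1) obtain a where "interval_anchor_assignment f a" by auto
  then show "NN f \<le> num_intervals f" by (rule NN_le_num_intervals)
next
  fix M :: "nat \<Rightarrow> real ^ 'n" assume M: "full_row_rank (num_intervals f - 1) M"
  obtain \<epsilon>\<^sub>0 where \<epsilon>\<^sub>0: "\<epsilon>\<^sub>0 > 0" "\<And>\<epsilon>. 0 < \<epsilon> \<and> \<epsilon> < \<epsilon>\<^sub>0 \<Longrightarrow>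
      \<exists>a. interval_anchor_assignment f a \<and>
        (\<forall>i\<in>{1..num_intervals f - 1}. a (i + 1) - a i = all_ones i + \<epsilon> *\<^sub>R M i)"
    using ex_interval_anchor_assignment[OF assms M] by blast
  show "\<exists>\<epsilon>\<^sub>0 > 0. \<forall>\<epsilon>. 0 < \<epsilon> \<and> \<epsilon> < \<epsilon>\<^sub>0 \<longrightarrow>
        (\<forall>B. (\<forall>i. B i = all_ones i + \<epsilon> *\<^sub>R M i) \<longrightarrow>
          (\<exists>a. interval_anchor_assignment f a \<and>
            (\<forall>i \<in> {1..num_intervals f - 1}. \<forall>j. a (i + 1) $ j - a i $ j = B i $ j)))"
  proof (intro exI[of _ \<epsilon>\<^sub>0] conjI allI impI)
    show "\<epsilon>\<^sub>0 > 0" by (rule \<epsilon>\<^sub>0(1))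
    fix \<epsilon> and B :: "nat \<Rightarrow> real ^ 'n"
    assume \<epsilon>: "0 < \<epsilon> \<and> \<epsilon> < \<epsilon>\<^sub>0" and B: "\<forall>i. B i = all_ones i + \<epsilon> *\<^sub>R M i"
    obtain a where a: "interval_anchor_assignment f a"
        "\<forall>i\<in>{1..num_intervals f - 1}. a (i + 1) - a i = B i"
      using \<epsilon>\<^sub>0(2)[OF \<epsilon>] B by auto
    have "\<forall>i\<in>{1..num_intervals f - 1}. \<forall>j. a (i + 1) $ j - a i $ j = B i $ j"
      using a(2) by (simp flip: vector_minus_component)
    then show "\<exists>a. interval_anchor_assignment f a \<and>
        (\<forall>i \<in> {1..num_intervals f - 1}. \<forall>j. a (i + 1) $ j - a i $ j = B i $ j)"
      using a(1) by blast
  qed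
qed

end
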